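(* (a) Let $\kappa\in\mathbf{k}$ and let $(R,P)$ be a modified Rota-Baxter algebra of weight $\kappa$. With $x\prec_P y:=xP(y)$, $x\succ_P y:=P(x)y$, $x\bullet_P y:=xy$ for $x,y\in R$, the quadruple $(R,\prec_P,\succ_P,\bullet_P)$ is a modified tridendriform algebra of weight $\kappa$. (b) Let $(R,P)$ be a Rota-Baxter algebra of weight $0$. With $\prec_P,\succ_P,\bullet_P$ defined by the same formulas, $(R,\prec_P,\succ_P,\bullet_P)$ is a tridendriform algebra of weight $0$.
   Context: $\mathbf{k}$ is a field of characteristic $0$; a $\mathbf{k}$-algebra is a nonunitary associative $\mathbf{k}$-algebra; all operations are bilinear. A modified Rota-Baxter algebra of weight $\kappa$ is a pair $(R,P)$ of a $\mathbf{k}$-algebra $R$ and a linear map $P:R\to R$ with $P(x)P(y)=P(xP(y))+P(P(x)y)+\kappa xy$ for all $x,y\in R$. A Rota-Baxter algebra of weight $0$ is such a pair with $P(x)P(y)=P(xP(y))+P(P(x)y)$ for all $x,y\in R$. A modified tridendriform algebra of weight $\kappa$ is a vector space $A$ with three binary operations $\prec,\succ,\bullet$ such that for all $x,y,z\in A$: $(x\prec y)\prec z=x\prec(y\prec z+y\succ z)+\kappa\, x\bullet(y\bullet z)$; $(x\succ y)\prec z=x\succ(y\prec z)$; $(x\prec y+x\succ y)\succ z+\kappa\,(x\bullet y)\bullet z=x\succ(y\succ z)$; $(x\succ y)\bullet z=x\succ(y\bullet z)$; $(x\prec y)\bullet z=x\bullet(y\succ z)$; $(x\bullet y)\prec z=x\bullet(y\prec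 z)$; $(x\bullet y)\bullet z=x\bullet(y\bullet z)$. A tridendriform algebra of weight $0$ is a modified tridendriform algebra of weight $\kappa=0$. *)

theory Defs
  imports Complex_Main
begin

definition bilinear_op :: "('k::field \<Rightarrow> 'a::ab_group_add \<Rightarrow> 'a) \<Rightarrow> ('a \<Rightarrow> 'a \<Rightarrow> 'a) \<Rightarrow> bool"
  where "bilinear_op scale f \<longleftrightarrow>
    (\<forall>x. Vector_Spaces.linear scale scale (\<lambda>y. f x y)) \<and>
    (\<forall>y. Vector_Spaces.linear scale scale (\<lambda>x. f x y))"

text \<open>The type class \<open>ring\<close> provides an associative, not necessarily unital or commutative, product.\<close>

locale nonunital_algebra = vector_space scale
  for scale :: "'k::field_char_0 \<Rightarrow> 'a::ring \<Rightarrow> 'a" +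
  assumes bilinear_mult: "bilinear_op scale (*)"

locale modified_rota_baxter_algebra = nonunital_algebra scale
  for scale :: "'k::field_char_0 \<Rightarrow> 'a::ring \<Rightarrow> 'a"
    and \<kappa> :: 'k
    and P :: "'a \<Rightarrow> 'a" +
  assumes linear_P: "Vector_Spaces.linear scale scale P"
    and modified_rota_baxter: "P x * P y = P (x * P y) + P (P x * y) + scale \<kappa> (x * y)"

locale rota_baxter_algebra_weight_zero = nonunital_algebra scale
  for scale :: "'k::field_char_0 \<Rightarrow> 'a::ring \<Rightarrow> 'a"
    and P :: "'a \<Rightarrow> 'a" +
  assumes linear_P: "Vector_Spaces.linear scale scale P"
    and rota_baxter: "P x * P y = P (x * P y) + P (P x * y)"

text \<open>The operations \<open>l\<close>, \<open>r\<close>, \<open>m\<close> are \<open>\<prec>\<close>, \<open>\<succ>\<close>, \<open>\<bullet>\<close> respectively.\<close>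

locale modified_tridendriform_algebra = vector_space scale
  for scale :: "'k::field_char_0 \<Rightarrow> 'a::ab_group_add \<Rightarrow> 'a"
    and \<kappa> :: 'k
    and l :: "'a \<Rightarrow> 'a \<Rightarrow> 'a" (infixl "\<prec>" 70)
    and r :: "'a \<Rightarrow> 'a \<Rightarrow> 'a" (infixl "\<succ>" 70)
    and m :: "'a \<Rightarrow> 'a \<Rightarrow> 'a" (infixl "\<bullet>" 70) +
  assumes bilinear_l: "bilinear_op scale (\<prec>)"
    and bilinear_r: "bilinear_op scale (\<succ>)"
    and bilinear_m: "bilinear_op scale (\<bullet>)"
    and l_l: "(x \<prec> y) \<prec> z = x \<prec> (y \<prec> z + y \<succ> z) + scale \<kappa> (x \<bullet> (y \<bullet> z))"
    and r_l: "(x \<succ> y) \<prec> z = x \<succ> (y \<prec> z)"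
    and r_r: "(x \<prec> y + x \<succ> y) \<succ> z + scale \<kappa> ((x \<bullet> y) \<bullet> z) = x \<succ> (y \<succ> z)"
    and r_m: "(x \<succ> y) \<bullet> z = x \<succ> (y \<bullet> z)"
    and l_m: "(x \<prec> y) \<bullet> z = x \<bullet> (y \<succ> z)"
    and m_l: "(x \<bullet> y) \<prec> z = x \<bullet> (y \<prec> z)"
    and m_m: "(x \<bullet> y) \<bullet> z = x \<bullet> (y \<bullet> z)"

definition tridendriform_algebra_weight_zero ::
    "('k::field_char_0 \<Rightarrow> 'a::ab_group_add \<Rightarrow> 'a) \<Rightarrow>
     ('a \<Rightarrow> 'a \<Rightarrow> 'a) \<Rightarrow> ('a \<Rightarrow> 'a \<Rightarrow> 'a) \<Rightarrow> ('a \<Rightarrow> 'a \<Rightarrow> 'a) \<Rightarrow> bool"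
  where "tridendriform_algebra_weight_zero scale l r m \<longleftrightarrow>
    modified_tridendriform_algebra scale 0 l r m"

definition prec_op :: "('a::ring \<Rightarrow> 'a) \<Rightarrow> 'a \<Rightarrow> 'a \<Rightarrow> 'a"
  where "prec_op P x y = x * P y"

definition succ_op :: "('a::ring \<Rightarrow> 'a) \<Rightarrow> 'a \<Rightarrow> 'a \<Rightarrow> 'a"
  where "succ_op P x y = P x * y"

text \<open>The middle product does not depend on \<open>P\<close>; the argument is kept for uniformity.\<close>

definition bullet_op :: "('a::ring \<Rightarrow> 'a) \<Rightarrow> 'a \<Rightarrow> 'a \<Rightarrow> 'a"
  where "bullet_op P x y = x * y"

end

theory Submission
  imports Defs
begin

text \<open>
  Two of the seven axioms carry content. Since \<open>P\<close> is additive, the modified Rota-Baxter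
  identity expresses \<open>P y * P z\<close> as \<open>P\<close> of the sum of the left and right products plus
  \<open>\<kappa> y z\<close>. Multiplying this on the left by \<open>x\<close> gives the axiom for iterated \<open>\<prec>\<close>, and
  multiplying the identity for \<open>x, y\<close> on the right by \<open>z\<close> gives the one for iterated \<open>\<succ>\<close>. The
  other five axioms are associativity of the product of \<open>R\<close>, with \<open>P\<close> applied to some of the
  factors. Bilinearity holds because each operation is the product precomposed with \<open>P\<close> in at
  most one argument.

  The weight zero case is the case \<open>\<kappa> = 0\<close>.
\<close>

lemma bilinear_op_precompose:
  assumes f: "bilinear_op scale f"
    and g: "Vector_Spaces.linear scale scale g"
    and h: "Vector_Spaces.linear scale scale h"
  shows "bilinear_op scale (\<lambda>x y. f (g x) (h y))"
proof -
  have "Vector_Spaces.linear scale scale (\<lambda>y. f (g x) (h y))" for x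
    using Vector_Spaces.linear_compose[OF h, of scale "\<lambda>y. f (g x) y"] f
    by (simp add: bilinear_op_def comp_def)
  moreover have "Vector_Spaces.linear scale scale (\<lambda>x. f (g x) (h y))" for y
    using Vector_Spaces.linear_compose[OF g, of scale "\<lambda>x. f x (h y)"] f
    by (simp add: bilinear_op_def comp_def)
  ultimately show ?thesis
    by (simp add: bilinear_op_def)
qed

context nonunital_algebra
begin

lemma scale_mult_left: "scale c x * y = scale c (x * y)"
proof -
  have "Vector_Spaces.linear scale scale (\<lambda>x. x * y)"
    using bilinear_mult by (simp add: bilinear_op_def)
  then show ?thesis
    by (rule module_hom.scale[OF Vector_Spaces.linear.axioms(3)])
qed

lemma scale_mult_right: "x * scale c y = scale c (x * y)"
proof -
  have "Vector_Spaces.linear scale scale (\<lambda>y. x * y)"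
    using bilinear_mult by (simp add: bilinear_op_def)
  then show ?thesis
    by (rule module_hom.scale[OF Vector_Spaces.linear.axioms(3)])
qed

end

context modified_rota_baxter_algebra
begin

lemma mult_eq_P_sum: "P x * P y = P (x * P y + P x * y) + scale \<kappa> (x * y)"
  by (simp add: modified_rota_baxter module_hom.add[OF Vector_Spaces.linear.axioms(3)[OF linear_P]])

lemma modified_tridendriform:
  "modified_tridendriform_algebra scale \<kappa> (prec_op P) (succ_op P) (bullet_op P)"
proof unfold_locales
  show "bilinear_op scale (prec_op P)"
    using bilinear_op_precompose[OF bilinear_mult linear_id linear_P]
    by (simp add: prec_op_def[abs_def])
  show "bilinear_op scale (succ_op P)"
    using bilinear_op_precompose[OF bilinear_mult linear_P linear_id]
    by (simp add: succ_op_def[abs_def])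
  show "bilinear_op scale (bullet_op P)"
    using bilinear_mult by (simp add: bullet_op_def[abs_def])
next
  fix x y z
  have "(x * P y) * P z = x * (P y * P z)"
    by (simp add: mult.assoc)
  also have "\<dots> = x * P (y * P z + P y * z) + scale \<kappa> (x * (y * z))"
    by (simp only: mult_eq_P_sum distrib_left scale_mult_right)
  finally show "prec_op P (prec_op P x y) z =
      prec_op P x (prec_op P y z + succ_op P y z) + scale \<kappa> (bullet_op P x (bullet_op P y z))"
    by (simp only: prec_op_def succ_op_def bullet_op_def)
  have "P (x * P y + P x * y) * z + scale \<kappa> ((x * y) * z) = (P x * P y) * z"
    by (simp only: mult_eq_P_sum distrib_right scale_mult_left)
  also have "\<dots> = P x * (P y * z)"
    by (simp add: mult.assoc)
  finally show "succ_op P (prec_op P x y + succ_op P x y) z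
      + scale \<kappa> (bullet_op P (bullet_op P x y) z) = succ_op P x (succ_op P y z)"
    by (simp only: prec_op_def succ_op_def bullet_op_def)
qed (simp_all add: prec_op_def succ_op_def bullet_op_def mult.assoc)

end

lemma (in rota_baxter_algebra_weight_zero) modified_rota_baxter_zero:
  "modified_rota_baxter_algebra scale 0 P"
  by (intro modified_rota_baxter_algebra.intro modified_rota_baxter_algebra_axioms.intro
      nonunital_algebra_axioms) (simp_all add: linear_P rota_baxter)

theorem corollary2p6:
  fixes scale :: "'k::field_char_0 \<Rightarrow> 'a::ring \<Rightarrow> 'a"
  shows "(\<forall>\<kappa> P. modified_rota_baxter_algebra scale \<kappa> P \<longrightarrow>
            modified_tridendriform_algebra scale \<kappa> (prec_op P) (succ_op P) (bullet_op P)) \<and>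
         (\<forall>P. rota_baxter_algebra_weight_zero scale P \<longrightarrow>
            tridendriform_algebra_weight_zero scale (prec_op P) (succ_op P) (bullet_op P))"
  by (simp add: tridendriform_algebra_weight_zero_def
      modified_rota_baxter_algebra.modified_tridendriform
      rota_baxter_algebra_weight_zero.modified_rota_baxter_zero)

end
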